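(* Let $a,b$ be real numbers. For every integer $n\ge 3$, the bi-periodic Perrin sequence and the bi-periodic Padovan sequence satisfy $$R_n(a,b)=\begin{cases}3P_{n-3}(a,b)+2P_{n-2}(a,b), & \text{if } n \text{ is even},\\ 3P_{n-3}(b,a)+2P_{n-2}(b,a), & \text{if } n \text{ is odd}.\end{cases}$$
   Context: The bi-periodic Padovan sequence $\{P_n(a,b)\}_{n\ge 0}$ is defined by $P_0(a,b)=1$, $P_1(a,b)=0$, $P_2(a,b)=a$ and, for $n\ge 3$, $P_n(a,b)=aP_{n-2}(a,b)+P_{n-3}(a,b)$ if $n$ is even, $P_n(a,b)=bP_{n-2}(a,b)+P_{n-3}(a,b)$ if $n$ is odd. The bi-periodic Perrin sequence $\{R_n(a,b)\}_{n\ge 0}$ satisfies the same recurrence for $n\ge 3$ (coefficient $a$ for $n$ even, $b$ for $n$ odd), with initial values $R_0(a,b)=3$, $R_1(a,b)=0$, $R_2(a,b)=2$. The sequence $P_n(b,a)$ is obtained from $P_n(a,b)$ by interchanging the roles of $a$ and $b$ (in particular $P_2(b,a)=b$). *)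

theory Defs
  imports Complex_Main
begin

fun padovan :: "real \<Rightarrow> real \<Rightarrow> nat \<Rightarrow> real" where
  "padovan a b 0 = 1"
| "padovan a b (Suc 0) = 0"
| "padovan a b (Suc (Suc 0)) = a"
| "padovan a b (Suc (Suc (Suc n))) =
     (if even (Suc (Suc (Suc n))) then a else b) * padovan a b (Suc n) + padovan a b n"

fun perrin :: "real \<Rightarrow> real \<Rightarrow> nat \<Rightarrow> real" where
  "perrin a b 0 = 3"
| "perrin a b (Suc 0) = 0"
| "perrin a b (Suc (Suc 0)) = 2"
| "perrin a b (Suc (Suc (Suc n))) =
     (if even (Suc (Suc (Suc n))) then a else b) * perrin a b (Suc n) + perrin a b n"

end

theory Submission
  imports Defs
begin

text \<open>A shift by two keeps parity and a shift by three flips it, so P_{n-2}(a,b) and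
  P_{n-3}(b,a) both obey the recurrence of R_n(a,b); the initial values fix the weights 2 and 3. At
  odd indices P is symmetric in a and b (\<open>padovan_swap\<close>), so one parameter order serves
  both terms. \<open>perrin_padovan\<close> is the induction.\<close>

text \<open>The even case makes the induction close: its correction (b - a) P_{n+1} turns the
  coefficient a into b in the next odd term.\<close>

lemma padovan_swap:
  "padovan b a n =
    (if even n then padovan a b n + (b - a) * padovan a b (Suc n) else padovan a b n)"
proof (induction a b n rule: padovan.induct)
  case (4 a b n)
  show ?case
  proof (cases "even n")
    case True
    with "4.IH" show ?thesis by (simp add: algebra_simps)
  next
    case False
    with "4.IH" have "padovan b a (Suc n) = padovan a b (Suc n) + (b - a) * padovan a b (Suc (Suc n))"
      and "padovan b a n = padovan a b n"
      by simp_all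
    with False show ?thesis by simp (simp only: algebra_simps)
  qed
qed (simp_all add: eval_nat_numeral)

text \<open>Written at index n + 3, whose parity is opposite to that of n; hence (b,a) goes with
  even n here.\<close>

lemma perrin_padovan:
  "perrin a b (Suc (Suc (Suc n))) =
    (if even n then 3 * padovan b a n + 2 * padovan b a (Suc n)
     else 3 * padovan a b n + 2 * padovan a b (Suc n))"
proof (induction a b n rule: perrin.induct)
  case (4 a b n)
  have step: "perrin a b (Suc (Suc (Suc (Suc (Suc (Suc n)))))) =
      (if even n then a else b) * perrin a b (Suc (Suc (Suc (Suc n)))) +
      perrin a b (Suc (Suc (Suc n)))"
    by simp
  show ?case
  proof (cases "even n")
    case True
    then show ?thesis
      \<comment> \<open>The hypotheses at n + 1 and n come in opposite parameter orders;
        \<open>padovan_swap\<close> brings all terms to (a,b).\<close>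
      unfolding step "4.IH"
      using padovan_swap[of b a n] padovan_swap[of b a "Suc n"]
        padovan_swap[of b a "Suc (Suc n)"]
      by (simp add: algebra_simps)
  next
    case False
    then show ?thesis
      unfolding step "4.IH"
      using padovan_swap[of b a n] padovan_swap[of b a "Suc n"]
        padovan_swap[of b a "Suc (Suc n)"]
      by (simp add: algebra_simps)
  qed
qed simp_all

theorem proposition2:
  fixes a b :: real and n :: nat
  assumes "n \<ge> 3"
  shows "perrin a b n =
    (if even n then 3 * padovan a b (n - 3) + 2 * padovan a b (n - 2)
     else 3 * padovan b a (n - 3) + 2 * padovan b a (n - 2))"
proof -
  obtain m where "n = Suc (Suc (Suc m))"
    using assms by (metis Suc_le_D Suc_le_mono numeral_3_eq_3)
  moreover from this have "n - 3 = m" "n - 2 = Suc m" by simp_all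
  ultimately show ?thesis
    using perrin_padovan[of a b m] by (simp del: perrin.simps padovan.simps)
qed

end
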